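(* Let $\mathcal{D}$ be an extriangulated category with negative first extension. Then any extended tilting object $V\in\mathcal{D}$ is $\mathbb{E}$-universal.
   Context: Extriangulated categories $(\mathcal{D},\mathbb{E},\mathfrak{s})$ are in the sense of Nakaoka–Palu; an $\mathfrak{s}$-conflation (= $\mathbb{E}$-triangle) is a sequence $A\to B\to C$ realizing an element of $\mathbb{E}(C,A)$. $\mathcal{D}$ has negative first extension if there are an additive bifunctor $\mathbb{E}^{-1}:\mathcal{D}^{op}\times\mathcal{D}\to\mathrm{Ab}$ and, for each $\delta\in\mathbb{E}(C,A)$, natural transformations $\delta^{-1}:\mathbb{E}^{-1}(-,C)\to\mathcal{D}(-,A)$ and $\delta_{-1}:\mathbb{E}^{-1}(A,-)\to\mathcal{D}(C,-)$ such that, for each $\mathfrak{s}$-conflation $A\to B\to C$ realizing $\delta$ and each $W\in\mathcal{D}$, the sequences $\mathbb{E}^{-1}(W,A)\to\mathbb{E}^{-1}(W,B)\to\mathbb{E}^{-1}(W,C)\xrightarrow{\delta^{-1}}\mathcal{D}(W,A)\to\mathcal{D}(W,B)$ and $\mathbb{E}^{-1}(C,W)\to\mathbb{E}^{-1}(B,W)\to\mathbb{E}^{-1}(A,W)\xrightarrow{\delta_{-1}}\mathcal{D}(C,W)\to\mathcal{D}(B,W)$ are exact. Put $\mathbb{E}^1=\mathbb{E}$, $\mathbb{E}^0=\mathrm{Hom}_{\mathcal{D}}$. An $s$-torsion pair in $\mathcal{D}$ is a pair $(\mathcal{T},\mathcal{F})$ of full isomorphism-closed subcategories with $\mathcal{D}(\mathcal{T},\mathcal{F})=0$,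 $\mathbb{E}^{-1}(\mathcal{T},\mathcal{F})=0$, and such that every $D\in\mathcal{D}$ admits an $\mathfrak{s}$-conflation $T\to D\to F$ with $T\in\mathcal{T}$, $F\in\mathcal{F}$. For $V\in\mathcal{D}$: $V^{\perp_i}=\{X\in\mathcal{D}:\mathbb{E}^i(V,X)=0\}$. $\mathrm{Gen}(V)$ is the class of $X$ such that $X=0$ or there is an $\mathfrak{s}$-conflation $A\to\coprod_\alpha V\xrightarrow{f}X$ for some set $\alpha$ (for which the coproduct exists) with $f\ne0$; $\mathrm{Pres}(V)$ is the class of $X$ such that $X=0$ or there is such a conflation with moreover $A\in\mathrm{Gen}(V)$. A class $\mathcal{S}$ is cogenerating in $\mathcal{D}$ if every $X\in\mathcal{D}$ admits an $\mathfrak{s}$-conflation $X\to S\to X'$ with $S\in\mathcal{S}$. $V$ is extended tilting if (T1) $(\mathrm{Gen}(V),V^{\perp_0})$ is an $s$-torsion pair in $\mathcal{D}$; (T2) $\mathrm{Gen}(V)=\mathrm{Pres}(V)$ and $\mathrm{Gen}(V)\subseteq V^{\perp_1}$; (T3) $\mathrm{Gen}(V)$ is cogenerating in $\mathcal{D}$. $V$ is $\mathbb{E}$-universal if for every $D\in\mathcal{D}$ there is an $\mathfrak{s}$-conflation $\varepsilon: D\to A\to\coprod_\alpha V$ in $\mathcal{D}$, for some set $\alpha\neq\emptyset$, such that the canonical connecting map $\mathrm{Hom}_{\mathcal{D}}(V,\coprod_\alpha V)\to\mathbb{E}^1(V,D)$, $g\mapsto\mathbb{E}(g,D)(\varepsilon)$,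 is surjective. *)

theory Defs
  imports "HOL-Algebra.Coset"
begin

section \<open>Additive categories\<close>

text \<open>
  The objects of the category are the elements of the type \<open>'o\<close>. Abelian groups are
  rendered by \<^const>\<open>comm_group\<close>, so \<open>\<otimes>\<close> and \<open>\<one>\<close> of a morphism or extension
  group stand for addition and zero.
\<close>

record ('o, 'm) cat =
  Hom :: "'o \<Rightarrow> 'o \<Rightarrow> 'm monoid"
  cmp :: "'m \<Rightarrow> 'm \<Rightarrow> 'm"  (infixl "\<cdot>\<index>" 75)
  ident :: "'o \<Rightarrow> 'm"  ("\<iota>\<index>")

abbreviation zero_mor :: "('o, 'm, 'z) cat_scheme \<Rightarrow> 'o \<Rightarrow> 'o \<Rightarrow> 'm" where
  "zero_mor D A B \<equiv> \<one>\<^bsub>Hom D A B\<^esub>"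

abbreviation mor :: "('o, 'm, 'z) cat_scheme \<Rightarrow> 'm \<Rightarrow> 'o \<Rightarrow> 'o \<Rightarrow> bool" where
  "mor D f A B \<equiv> f \<in> carrier (Hom D A B)"

definition trivial_grp :: "'g monoid \<Rightarrow> bool" where
  "trivial_grp G \<longleftrightarrow> carrier G = {\<one>\<^bsub>G\<^esub>}"

definition zero_object :: "('o, 'm, 'z) cat_scheme \<Rightarrow> 'o \<Rightarrow> bool" where
  "zero_object D Z \<longleftrightarrow> (\<forall>X. (\<exists>!f. mor D f X Z) \<and> (\<exists>!f. mor D f Z X))"

definition is_iso :: "('o, 'm, 'z) cat_scheme \<Rightarrow> 'o \<Rightarrow> 'o \<Rightarrow> 'm \<Rightarrow> bool" where
  "is_iso D A B f \<longleftrightarrow> mor D f A B \<and>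
     (\<exists>g. mor D g B A \<and> g \<cdot>\<^bsub>D\<^esub> f = \<iota>\<^bsub>D\<^esub> A \<and> f \<cdot>\<^bsub>D\<^esub> g = \<iota>\<^bsub>D\<^esub> B)"

definition iso_closed :: "('o, 'm, 'z) cat_scheme \<Rightarrow> 'o set \<Rightarrow> bool" where
  "iso_closed D S \<longleftrightarrow> (\<forall>X Y f. X \<in> S \<longrightarrow> is_iso D X Y f \<longrightarrow> Y \<in> S)"

definition biproduct ::
  "('o, 'm, 'z) cat_scheme \<Rightarrow> 'o \<Rightarrow> 'o \<Rightarrow> 'o \<Rightarrow> 'm \<Rightarrow> 'm \<Rightarrow> 'm \<Rightarrow> 'm \<Rightarrow> bool" where
  "biproduct D A B P i j p q \<longleftrightarrow>
     mor D i A P \<and> mor D j B P \<and> mor D p P A \<and> mor D q P B \<and>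
     p \<cdot>\<^bsub>D\<^esub> i = \<iota>\<^bsub>D\<^esub> A \<and> q \<cdot>\<^bsub>D\<^esub> j = \<iota>\<^bsub>D\<^esub> B \<and>
     p \<cdot>\<^bsub>D\<^esub> j = zero_mor D B A \<and> q \<cdot>\<^bsub>D\<^esub> i = zero_mor D A B \<and>
     (i \<cdot>\<^bsub>D\<^esub> p) \<otimes>\<^bsub>Hom D P P\<^esub> (j \<cdot>\<^bsub>D\<^esub> q) = \<iota>\<^bsub>D\<^esub> P"

definition is_coproduct ::
  "('o, 'm, 'z) cat_scheme \<Rightarrow> 'i set \<Rightarrow> ('i \<Rightarrow> 'o) \<Rightarrow> 'o \<Rightarrow> ('i \<Rightarrow> 'm) \<Rightarrow> bool" where
  "is_coproduct D I X W \<nu> \<longleftrightarrow>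
     (\<forall>i\<in>I. mor D (\<nu> i) (X i) W) \<and>
     (\<forall>Y h. (\<forall>i\<in>I. mor D (h i) (X i) Y) \<longrightarrow>
        (\<exists>!u. mor D u W Y \<and> (\<forall>i\<in>I. u \<cdot>\<^bsub>D\<^esub> \<nu> i = h i)))"

locale additive_category =
  fixes D :: "('o, 'm, 'z) cat_scheme" (structure)
  assumes hom_disjoint: "mor D f A B \<Longrightarrow> mor D f A' B' \<Longrightarrow> A = A' \<and> B = B'"
    and ident_mor: "mor D (\<iota> A) A A"
    and comp_mor: "mor D f A B \<Longrightarrow> mor D g B C \<Longrightarrow> mor D (g \<cdot> f) A C"
    and ident_left: "mor D f A B \<Longrightarrow> \<iota> B \<cdot> f = f"
    and ident_right: "mor D f A B \<Longrightarrow> f \<cdot> \<iota> A = f"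
    and comp_assoc: "mor D f A B \<Longrightarrow> mor D g B C \<Longrightarrow> mor D h C E \<Longrightarrow> (h \<cdot> g) \<cdot> f = h \<cdot> (g \<cdot> f)"
    and hom_comm_group: "comm_group (Hom D A B)"
    and comp_add_left: "mor D f A B \<Longrightarrow> mor D g B C \<Longrightarrow> mor D g' B C \<Longrightarrow>
          (g \<otimes>\<^bsub>Hom D B C\<^esub> g') \<cdot> f = (g \<cdot> f) \<otimes>\<^bsub>Hom D A C\<^esub> (g' \<cdot> f)"
    and comp_add_right: "mor D f A B \<Longrightarrow> mor D f' A B \<Longrightarrow> mor D g B C \<Longrightarrow>
          g \<cdot> (f \<otimes>\<^bsub>Hom D A B\<^esub> f') = (g \<cdot> f) \<otimes>\<^bsub>Hom D A C\<^esub> (g \<cdot> f')"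
    and ex_zero_object: "\<exists>Z. zero_object D Z"
    and ex_biproduct: "\<exists>P i j p q. biproduct D A B P i j p q"

text \<open>
  \<open>F C A\<close> is the value of the bifunctor (contravariant in \<open>C\<close>), and \<open>\<phi> c a\<close> its action
  on morphisms \<open>c : C' \<rightarrow> C\<close> and \<open>a : A \<rightarrow> A'\<close>.
\<close>

locale additive_bifunctor = additive_category D
  for D :: "('o, 'm, 'z) cat_scheme" (structure)
    and F :: "'o \<Rightarrow> 'o \<Rightarrow> 'e monoid" and \<phi> :: "'m \<Rightarrow> 'm \<Rightarrow> 'e \<Rightarrow> 'e" +
  assumes comm_group: "comm_group (F C A)"
    and map_hom: "mor D c C' C \<Longrightarrow> mor D a A A' \<Longrightarrow> \<phi> c a \<in> hom (F C A) (F C' A')"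
    and map_ident: "x \<in> carrier (F C A) \<Longrightarrow> \<phi> (\<iota> C) (\<iota> A) x = x"
    and map_comp: "mor D c C' C \<Longrightarrow> mor D c' C'' C' \<Longrightarrow> mor D a A A' \<Longrightarrow> mor D a' A' A'' \<Longrightarrow>
          x \<in> carrier (F C A) \<Longrightarrow> \<phi> (c \<cdot> c') (a' \<cdot> a) x = \<phi> c' a' (\<phi> c a x)"
    and map_add_left: "mor D c\<^sub>1 C' C \<Longrightarrow> mor D c\<^sub>2 C' C \<Longrightarrow> x \<in> carrier (F C A) \<Longrightarrow>
          \<phi> (c\<^sub>1 \<otimes>\<^bsub>Hom D C' C\<^esub> c\<^sub>2) (\<iota> A) x = \<phi> c\<^sub>1 (\<iota> A) x \<otimes>\<^bsub>F C' A\<^esub> \<phi> c\<^sub>2 (\<iota> A) x"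
    and map_add_right: "mor D a\<^sub>1 A A' \<Longrightarrow> mor D a\<^sub>2 A A' \<Longrightarrow> x \<in> carrier (F C A) \<Longrightarrow>
          \<phi> (\<iota> C) (a\<^sub>1 \<otimes>\<^bsub>Hom D A A'\<^esub> a\<^sub>2) x = \<phi> (\<iota> C) a\<^sub>1 x \<otimes>\<^bsub>F C A'\<^esub> \<phi> (\<iota> C) a\<^sub>2 x"

section \<open>Extriangulated categories\<close>

text \<open>
  \<open>realization D C A \<delta>\<close> is the class s(\<open>\<delta>\<close>) of \<open>\<delta> \<in> Ext C A\<close>; a sequence \<open>A \<rightarrow> B \<rightarrow> C\<close> with maps
  \<open>x\<close>, \<open>y\<close> is encoded as the triple \<open>(B, x, y)\<close>.
\<close>

record ('o, 'm, 'e) extri = "('o, 'm) cat" +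
  Ext :: "'o \<Rightarrow> 'o \<Rightarrow> 'e monoid"
  extmap :: "'m \<Rightarrow> 'm \<Rightarrow> 'e \<Rightarrow> 'e"
  realization :: "'o \<Rightarrow> 'o \<Rightarrow> 'e \<Rightarrow> ('o \<times> 'm \<times> 'm) set"

definition sequences :: "('o, 'm, 'z) cat_scheme \<Rightarrow> 'o \<Rightarrow> 'o \<Rightarrow> ('o \<times> 'm \<times> 'm) set" where
  "sequences D A C = {(B, x, y). mor D x A B \<and> mor D y B C}"

definition seq_equiv ::
  "('o, 'm, 'z) cat_scheme \<Rightarrow> 'o \<Rightarrow> 'o \<Rightarrow> (('o \<times> 'm \<times> 'm) \<times> ('o \<times> 'm \<times> 'm)) set" where
  "seq_equiv D A C = {((B, x, y), (B', x', y')).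
     (B, x, y) \<in> sequences D A C \<and> (B', x', y') \<in> sequences D A C \<and>
     (\<exists>b. is_iso D B B' b \<and> b \<cdot>\<^bsub>D\<^esub> x = x' \<and> y' \<cdot>\<^bsub>D\<^esub> b = y)}"

definition push :: "('o, 'm, 'e, 'z) extri_scheme \<Rightarrow> 'o \<Rightarrow> 'm \<Rightarrow> 'e \<Rightarrow> 'e" where
  "push D C a \<delta> = extmap D (\<iota>\<^bsub>D\<^esub> C) a \<delta>"

definition pull :: "('o, 'm, 'e, 'z) extri_scheme \<Rightarrow> 'o \<Rightarrow> 'm \<Rightarrow> 'e \<Rightarrow> 'e" where
  "pull D A c \<delta> = extmap D c (\<iota>\<^bsub>D\<^esub> A) \<delta>"

definition realizes ::
  "('o, 'm, 'e, 'z) extri_scheme \<Rightarrow> 'o \<Rightarrow> 'm \<Rightarrow> 'o \<Rightarrow> 'm \<Rightarrow> 'o \<Rightarrow> 'e \<Rightarrow> bool" where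
  "realizes D A x B y C \<delta> \<longleftrightarrow> \<delta> \<in> carrier (Ext D C A) \<and> (B, x, y) \<in> realization D C A \<delta>"

definition conflation ::
  "('o, 'm, 'e, 'z) extri_scheme \<Rightarrow> 'o \<Rightarrow> 'm \<Rightarrow> 'o \<Rightarrow> 'm \<Rightarrow> 'o \<Rightarrow> bool" where
  "conflation D A x B y C \<longleftrightarrow> (\<exists>\<delta>. realizes D A x B y C \<delta>)"

text \<open>
  In \<open>real_sum\<close>, \<open>\<theta>\<close> is \<open>\<delta> \<oplus> \<delta>'\<close>: the element corresponding to \<open>(\<delta>, 0, 0, \<delta>')\<close> under
  \<open>Ext(C \<oplus> C', A \<oplus> A') \<cong> Ext(C,A) \<oplus> Ext(C,A') \<oplus> Ext(C',A) \<oplus> Ext(C',A')\<close>.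
\<close>

locale extriangulated_category = additive_bifunctor D "Ext D" "extmap D"
  for D :: "('o, 'm, 'e, 'z) extri_scheme" (structure) +
  assumes real_class:
      "\<delta> \<in> carrier (Ext D C A) \<Longrightarrow> realization D C A \<delta> \<in> sequences D A C // seq_equiv D A C"
    and real_mor:
      "realizes D A x B y C \<delta> \<Longrightarrow> realizes D A' x' B' y' C' \<delta>' \<Longrightarrow>
       mor D a A A' \<Longrightarrow> mor D c C C' \<Longrightarrow> push D C a \<delta> = pull D A' c \<delta>' \<Longrightarrow>
       \<exists>b. mor D b B B' \<and> b \<cdot> x = x' \<cdot> a \<and> y' \<cdot> b = c \<cdot> y"
    and real_zero:
      "biproduct D A C P i j p q \<Longrightarrow> realizes D A i P q C \<one>\<^bsub>Ext D C A\<^esub>"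
    and real_sum:
      "realizes D A x B y C \<delta> \<Longrightarrow> realizes D A' x' B' y' C' \<delta>' \<Longrightarrow>
       biproduct D A A' SA iA iA' pA pA' \<Longrightarrow>
       biproduct D B B' SB iB iB' pB pB' \<Longrightarrow>
       biproduct D C C' SC iC iC' pC pC' \<Longrightarrow>
       \<theta> \<in> carrier (Ext D SC SA) \<Longrightarrow>
       extmap D iC pA \<theta> = \<delta> \<Longrightarrow> extmap D iC pA' \<theta> = \<one>\<^bsub>Ext D C A'\<^esub> \<Longrightarrow>
       extmap D iC' pA \<theta> = \<one>\<^bsub>Ext D C' A\<^esub> \<Longrightarrow> extmap D iC' pA' \<theta> = \<delta>' \<Longrightarrow>
       realizes D SA ((iB \<cdot> x \<cdot> pA) \<otimes>\<^bsub>Hom D SA SB\<^esub> (iB' \<cdot> x' \<cdot> pA'))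
                SB ((iC \<cdot> y \<cdot> pB) \<otimes>\<^bsub>Hom D SB SC\<^esub> (iC' \<cdot> y' \<cdot> pB')) SC \<theta>"
    and ET3:
      "realizes D A x B y C \<delta> \<Longrightarrow> realizes D A' x' B' y' C' \<delta>' \<Longrightarrow>
       mor D a A A' \<Longrightarrow> mor D b B B' \<Longrightarrow> b \<cdot> x = x' \<cdot> a \<Longrightarrow>
       \<exists>c. mor D c C C' \<and> c \<cdot> y = y' \<cdot> b \<and> push D C a \<delta> = pull D A' c \<delta>'"
    and ET3_op:
      "realizes D A x B y C \<delta> \<Longrightarrow> realizes D A' x' B' y' C' \<delta>' \<Longrightarrow>
       mor D b B B' \<Longrightarrow> mor D c C C' \<Longrightarrow> y' \<cdot> b = c \<cdot> y \<Longrightarrow>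
       \<exists>a. mor D a A A' \<and> b \<cdot> x = x' \<cdot> a \<and> push D C a \<delta> = pull D A' c \<delta>'"
    and ET4:
      "realizes D A f B f' X \<delta> \<Longrightarrow> realizes D B g C g' Y \<delta>' \<Longrightarrow>
       \<exists>E d e h h' \<delta>''.
         mor D d X E \<and> mor D e E Y \<and>
         h = g \<cdot> f \<and> h' \<cdot> g = d \<cdot> f' \<and> e \<cdot> h' = g' \<and>
         realizes D A h C h' E \<delta>'' \<and>
         realizes D X d E e Y (push D Y f' \<delta>') \<and>
         pull D A d \<delta>'' = \<delta> \<and>
         push D E f \<delta>'' = pull D B e \<delta>'"
    and ET4_op:
      "realizes D X f' A f B \<delta> \<Longrightarrow> realizes D Y g' B g C \<delta>' \<Longrightarrow>
       \<exists>E d e h h' \<delta>''.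
         mor D d X E \<and> mor D e E Y \<and>
         h = g \<cdot> f \<and> h' \<cdot> d = f' \<and> f \<cdot> h' = g' \<cdot> e \<and>
         realizes D E h' A h C \<delta>'' \<and>
         realizes D X d E e Y (pull D X g' \<delta>) \<and>
         push D C e \<delta>'' = \<delta>' \<and>
         push D B d \<delta> = pull D E g \<delta>''"

section \<open>Negative first extensions\<close>

text \<open>
  \<open>conn_cov D C A \<delta> W : NExt(W,C) \<rightarrow> Hom(W,A)\<close> is the component at \<open>W\<close> of \<open>\<delta>\<^sup>-\<^sup>1\<close>, and
  \<open>conn_con D C A \<delta> W : NExt(A,W) \<rightarrow> Hom(C,W)\<close> that of \<open>\<delta>\<^sub>-\<^sub>1\<close>.
\<close>

record ('o, 'm, 'e, 'n) neg_extri = "('o, 'm, 'e) extri" +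
  NExt :: "'o \<Rightarrow> 'o \<Rightarrow> 'n monoid"
  nextmap :: "'m \<Rightarrow> 'm \<Rightarrow> 'n \<Rightarrow> 'n"
  conn_cov :: "'o \<Rightarrow> 'o \<Rightarrow> 'e \<Rightarrow> 'o \<Rightarrow> 'n \<Rightarrow> 'm"
  conn_con :: "'o \<Rightarrow> 'o \<Rightarrow> 'e \<Rightarrow> 'o \<Rightarrow> 'n \<Rightarrow> 'm"

definition exact_at ::
  "'a monoid \<Rightarrow> ('a \<Rightarrow> 'b) \<Rightarrow> 'b monoid \<Rightarrow> ('b \<Rightarrow> 'c) \<Rightarrow> 'c monoid \<Rightarrow> bool" where
  "exact_at G f H g K \<longleftrightarrow> f ` carrier G = kernel H K g"

locale neg_extriangulated_category =
  extriangulated_category D + neg: additive_bifunctor D "NExt D" "nextmap D"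
  for D :: "('o, 'm, 'e, 'n, 'z) neg_extri_scheme" (structure) +
  assumes conn_cov_hom:
      "\<delta> \<in> carrier (Ext D C A) \<Longrightarrow> conn_cov D C A \<delta> W \<in> hom (NExt D W C) (Hom D W A)"
    and conn_cov_natural:
      "\<delta> \<in> carrier (Ext D C A) \<Longrightarrow> mor D w W' W \<Longrightarrow> u \<in> carrier (NExt D W C) \<Longrightarrow>
       conn_cov D C A \<delta> W' (nextmap D w (\<iota> C) u) = conn_cov D C A \<delta> W u \<cdot> w"
    and conn_con_hom:
      "\<delta> \<in> carrier (Ext D C A) \<Longrightarrow> conn_con D C A \<delta> W \<in> hom (NExt D A W) (Hom D C W)"
    and conn_con_natural:
      "\<delta> \<in> carrier (Ext D C A) \<Longrightarrow> mor D w W W' \<Longrightarrow> u \<in> carrier (NExt D A W) \<Longrightarrow>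
       conn_con D C A \<delta> W' (nextmap D (\<iota> A) w u) = w \<cdot> conn_con D C A \<delta> W u"
    and exact_cov:
      "realizes D A x B y C \<delta> \<Longrightarrow>
       exact_at (NExt D W A) (nextmap D (\<iota> W) x) (NExt D W B) (nextmap D (\<iota> W) y) (NExt D W C) \<and>
       exact_at (NExt D W B) (nextmap D (\<iota> W) y) (NExt D W C) (conn_cov D C A \<delta> W) (Hom D W A) \<and>
       exact_at (NExt D W C) (conn_cov D C A \<delta> W) (Hom D W A) (\<lambda>f. x \<cdot> f) (Hom D W B)"
    and exact_con:
      "realizes D A x B y C \<delta> \<Longrightarrow>
       exact_at (NExt D C W) (nextmap D y (\<iota> W)) (NExt D B W) (nextmap D x (\<iota> W)) (NExt D A W) \<and>
       exact_at (NExt D B W) (nextmap D x (\<iota> W)) (NExt D A W) (conn_con D C A \<delta> W) (Hom D C W) \<and>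
       exact_at (NExt D A W) (conn_con D C A \<delta> W) (Hom D C W) (\<lambda>f. f \<cdot> y) (Hom D B W)"

section \<open>Extended tilting and universal objects\<close>

definition s_torsion_pair ::
  "('o, 'm, 'e, 'n, 'z) neg_extri_scheme \<Rightarrow> 'o set \<Rightarrow> 'o set \<Rightarrow> bool" where
  "s_torsion_pair D \<T> \<F> \<longleftrightarrow>
     iso_closed D \<T> \<and> iso_closed D \<F> \<and>
     (\<forall>T\<in>\<T>. \<forall>F\<in>\<F>. trivial_grp (Hom D T F)) \<and>
     (\<forall>T\<in>\<T>. \<forall>F\<in>\<F>. trivial_grp (NExt D T F)) \<and>
     (\<forall>X. \<exists>T\<in>\<T>. \<exists>F\<in>\<F>. \<exists>x y. conflation D T x X y F)"

definition perp\<^sub>0 :: "('o, 'm, 'z) cat_scheme \<Rightarrow> 'o \<Rightarrow> 'o set" where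
  "perp\<^sub>0 D V = {X. trivial_grp (Hom D V X)}"

definition perp\<^sub>1 :: "('o, 'm, 'e, 'z) extri_scheme \<Rightarrow> 'o \<Rightarrow> 'o set" where
  "perp\<^sub>1 D V = {X. trivial_grp (Ext D V X)}"

text \<open>
  The index set \<open>\<alpha>\<close> of a coproduct of copies of \<open>V\<close> is an arbitrary set. By the following
  lemma, a coproduct of copies of \<open>V\<close> over any index type is also one indexed by its set of
  injections, so it is enough to let \<open>\<alpha>\<close> range over sets of morphisms.
\<close>

lemma coproduct_copies_reindex:
  fixes I :: "'i set"
  assumes "is_coproduct D I (\<lambda>_. V) W \<nu>"
  shows "is_coproduct D (\<nu> ` I) (\<lambda>_. V) W (\<lambda>j. j)"
  unfolding is_coproduct_def
proof (intro conjI ballI allI impI)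
  show "mor D j V W" if "j \<in> \<nu> ` I" for j
    using assms that by (auto simp: is_coproduct_def)
next
  fix Y h assume "\<forall>j\<in>\<nu> ` I. mor D (h j) V Y"
  then have "\<forall>i\<in>I. mor D ((h \<circ> \<nu>) i) V Y" by simp
  then have "\<exists>!u. mor D u W Y \<and> (\<forall>i\<in>I. u \<cdot>\<^bsub>D\<^esub> \<nu> i = (h \<circ> \<nu>) i)"
    using assms unfolding is_coproduct_def by blast
  then show "\<exists>!u. mor D u W Y \<and> (\<forall>j\<in>\<nu> ` I. u \<cdot>\<^bsub>D\<^esub> j = h j)" by simp
qed

definition copower :: "('o, 'm, 'z) cat_scheme \<Rightarrow> 'm set \<Rightarrow> 'o \<Rightarrow> 'o \<Rightarrow> bool" where
  "copower D \<alpha> V W \<longleftrightarrow> (\<exists>\<nu>. is_coproduct D \<alpha> (\<lambda>_. V) W \<nu>)"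

definition Gen :: "('o, 'm, 'e, 'z) extri_scheme \<Rightarrow> 'o \<Rightarrow> 'o set" where
  "Gen D V = {X. zero_object D X \<or>
     (\<exists>\<alpha> W A x f. copower D \<alpha> V W \<and> conflation D A x W f X \<and> f \<noteq> zero_mor D W X)}"

definition Pres :: "('o, 'm, 'e, 'z) extri_scheme \<Rightarrow> 'o \<Rightarrow> 'o set" where
  "Pres D V = {X. zero_object D X \<or>
     (\<exists>\<alpha> W A x f. copower D \<alpha> V W \<and> conflation D A x W f X \<and> f \<noteq> zero_mor D W X \<and>
        A \<in> Gen D V)}"

definition cogenerating :: "('o, 'm, 'e, 'z) extri_scheme \<Rightarrow> 'o set \<Rightarrow> bool" where
  "cogenerating D \<S> \<longleftrightarrow> (\<forall>X. \<exists>S\<in>\<S>. \<exists>X' x y. conflation D X x S y X')"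

definition extended_tilting :: "('o, 'm, 'e, 'n, 'z) neg_extri_scheme \<Rightarrow> 'o \<Rightarrow> bool" where
  "extended_tilting D V \<longleftrightarrow>
     s_torsion_pair D (Gen D V) (perp\<^sub>0 D V) \<and>
     (Gen D V = Pres D V \<and> Gen D V \<subseteq> perp\<^sub>1 D V) \<and>
     cogenerating D (Gen D V)"

definition E_universal :: "('o, 'm, 'e, 'z) extri_scheme \<Rightarrow> 'o \<Rightarrow> bool" where
  "E_universal D V \<longleftrightarrow>
     (\<forall>X. \<exists>\<alpha> W A x y \<epsilon>. \<alpha> \<noteq> {} \<and> copower D \<alpha> V W \<and> realizes D X x A y W \<epsilon> \<and>
        (\<lambda>g. extmap D g (\<iota>\<^bsub>D\<^esub> X) \<epsilon>) ` carrier (Hom D V W) = carrier (Ext D V X))"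

end

theory Submission
  imports Defs
begin

text \<open>
  Embed \<open>X\<close> by a conflation \<open>X \<rightarrow> S \<rightarrow> X'\<close> with \<open>S\<close> in \<open>Gen V\<close>, and let \<open>T \<rightarrow> X' \<rightarrow> F\<close> be a torsion
  conflation of \<open>X'\<close>. The dual octahedron axiom yields conflations \<open>X \<rightarrow> E \<rightarrow> T\<close> and \<open>E \<rightarrow> S \<rightarrow> F\<close>.
  As \<open>Hom(V,F) = 0\<close> and \<open>Ext(V,S) = 0\<close>, also \<open>Ext(V,E) = 0\<close>, so \<open>Hom(V,T) \<rightarrow> Ext(V,X)\<close> is onto.
  Presenting \<open>T\<close> as \<open>K \<rightarrow> W \<rightarrow> T\<close> with \<open>W\<close> a copower of \<open>V\<close> and \<open>K\<close> in \<open>Gen V\<close>, the map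
  \<open>Hom(V,W) \<rightarrow> Hom(V,T)\<close> is onto because \<open>Ext(V,K) = 0\<close>. Hence the pullback of \<open>X \<rightarrow> E \<rightarrow> T\<close> along
  \<open>W \<rightarrow> T\<close> is a universal extension.
\<close>

lemma (in additive_category) zero_mor_mor: "mor D (zero_mor D A B) A B"
  using hom_comm_group[of A B] by (simp add: comm_group_def comm_monoid_def monoid.one_closed)

lemma (in additive_category) zero_object_mor_unique:
  assumes "zero_object D Z" "mor D f A Z" "mor D g A Z"
  shows "f = g"
  using assms unfolding zero_object_def by blast

text \<open>An empty coproduct is an initial object. This later rules out empty index sets.\<close>

lemma (in additive_category) copower_empty_mor_unique:
  assumes "copower D {} V W" "mor D f W Y" "mor D g W Y"
  shows "f = g"
  using assms unfolding copower_def is_coproduct_def by blast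

lemma (in additive_category) copower_singleton: "copower D {\<iota> V} V V"
  unfolding copower_def is_coproduct_def
  using ident_mor ident_right by (intro exI[of _ "\<lambda>_. \<iota> V"]) auto

lemma trivial_grpD: "trivial_grp G \<Longrightarrow> x \<in> carrier G \<Longrightarrow> x = \<one>\<^bsub>G\<^esub>"
  unfolding trivial_grp_def by blast

context extriangulated_category
begin

lemma group_Ext: "group (Ext D C A)"
  using comm_group by (simp add: comm_group_def)

lemma push_hom: "mor D a A A' \<Longrightarrow> push D C a \<in> hom (Ext D C A) (Ext D C A')"
  using map_hom[OF ident_mor, of a A A' C] by (simp add: push_def[abs_def])

lemma pull_hom: "mor D c C' C \<Longrightarrow> pull D A c \<in> hom (Ext D C A) (Ext D C' A)"
  using map_hom[OF _ ident_mor, of c C' C A] by (simp add: pull_def[abs_def])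

lemma push_ident: "\<delta> \<in> carrier (Ext D C A) \<Longrightarrow> push D C (\<iota> A) \<delta> = \<delta>"
  unfolding push_def by (rule map_ident)

lemma pull_comp:
  assumes "mor D c C' C" "mor D c' C'' C'" "\<delta> \<in> carrier (Ext D C A)"
  shows "pull D A (c \<cdot> c') \<delta> = pull D A c' (pull D A c \<delta>)"
  using map_comp[OF assms(1,2) ident_mor ident_mor assms(3)]
  by (simp add: pull_def ident_left[OF ident_mor])

lemma push_one: "mor D a A A' \<Longrightarrow> push D C a \<one>\<^bsub>Ext D C A\<^esub> = \<one>\<^bsub>Ext D C A'\<^esub>"
  using hom_one[OF push_hom group_Ext group_Ext] by blast

lemma pull_one: "mor D c C' C \<Longrightarrow> pull D A c \<one>\<^bsub>Ext D C A\<^esub> = \<one>\<^bsub>Ext D C' A\<^esub>"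
  using hom_one[OF pull_hom group_Ext group_Ext] by blast

text \<open>By additivity, 0 + 0 = 0 makes the pullback idempotent in a group, hence
  neutral.\<close>

lemma pull_zero_mor:
  assumes "\<delta> \<in> carrier (Ext D C A)"
  shows "pull D A (zero_mor D C' C) \<delta> = \<one>\<^bsub>Ext D C' A\<^esub>"
proof -
  let ?z = "zero_mor D C' C"
  have "?z \<otimes>\<^bsub>Hom D C' C\<^esub> ?z = ?z"
    using hom_comm_group[of C' C] by (simp add: comm_group_def group_def comm_monoid_def)
  then have "pull D A ?z \<delta> = pull D A ?z \<delta> \<otimes>\<^bsub>Ext D C' A\<^esub> pull D A ?z \<delta>"
    using map_add_left[OF zero_mor_mor zero_mor_mor assms, of C'] by (simp add: pull_def)
  moreover have "pull D A ?z \<delta> \<in> carrier (Ext D C' A)"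
    using hom_in_carrier[OF pull_hom[OF zero_mor_mor] assms] .
  ultimately show ?thesis
    using group.r_cancel_one'[OF group_Ext] by metis
qed

lemma realizes_mor:
  assumes "realizes D A x B y C \<delta>"
  shows "mor D x A B" "mor D y B C"
proof -
  have "realization D C A \<delta> \<in> sequences D A C // seq_equiv D A C"
    and "(B, x, y) \<in> realization D C A \<delta>"
    using assms real_class unfolding realizes_def by auto
  then have "(B, x, y) \<in> sequences D A C"
    by (auto simp: quotient_def seq_equiv_def)
  then show "mor D x A B" "mor D y B C"
    by (auto simp: sequences_def)
qed

lemma ex_realizes:
  assumes "\<delta> \<in> carrier (Ext D C A)"
  shows "\<exists>B x y. realizes D A x B y C \<delta>"
proof -
  obtain s where s: "s \<in> sequences D A C" "realization D C A \<delta> = seq_equiv D A C `` {s}"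
    using real_class[OF assms] by (auto elim: quotientE)
  obtain B x y where [simp]: "s = (B, x, y)"
    by (cases s)
  have xy: "mor D x A B" "mor D y B C"
    using s(1) by (auto simp: sequences_def)
  \<comment> \<open>Reflexivity of \<open>seq_equiv\<close> makes the class non-empty: it contains
    its representative.\<close>
  have "is_iso D B B (\<iota> B)"
    using ident_mor ident_left unfolding is_iso_def by blast
  then have "(s, s) \<in> seq_equiv D A C"
    using s(1) ident_left[OF xy(1)] ident_right[OF xy(2)] by (auto simp: seq_equiv_def)
  then show ?thesis
    using s(2) assms unfolding realizes_def by auto
qed

text \<open>This is exactness of Hom(W,B) \<rightarrow> Hom(W,C) \<rightarrow> Ext(W,A) in the
  middle. The zero class is realized by the split sequence through \<open>P\<close>; the pair of
  \<open>\<iota> A\<close> and \<open>g\<close> lifts to a map \<open>b\<close> from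
  \<open>P\<close> to \<open>B\<close>, and restricting \<open>b\<close> along the section
  \<open>j\<close> gives the lift of \<open>g\<close>.\<close>

lemma exact_Hom_third:
  assumes r: "realizes D A x B y C \<delta>" and g: "mor D g W C"
    and zero: "pull D A g \<delta> = \<one>\<^bsub>Ext D W A\<^esub>"
  shows "\<exists>h. mor D h W B \<and> y \<cdot> h = g"
proof -
  obtain P i j p q where P: "biproduct D A W P i j p q"
    using ex_biproduct by blast
  have j: "mor D j W P" and q: "mor D q P W" and qj: "q \<cdot> j = \<iota> W"
    using P unfolding biproduct_def by auto
  have "push D W (\<iota> A) \<one>\<^bsub>Ext D W A\<^esub> = pull D A g \<delta>"
    using zero push_one[OF ident_mor] by simp
  then obtain b where b: "mor D b P B" "y \<cdot> b = g \<cdot> q"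
    using real_mor[OF real_zero[OF P] r ident_mor g] by blast
  have y: "mor D y B C"
    using realizes_mor[OF r] by simp
  have "y \<cdot> (b \<cdot> j) = (g \<cdot> q) \<cdot> j"
    using comp_assoc[OF j b(1) y] b(2) by simp
  also have "\<dots> = g"
    using comp_assoc[OF j q g] qj ident_right[OF g] by simp
  finally show ?thesis
    using comp_mor[OF j b(1)] by blast
qed

text \<open>This is exactness of Hom(W,C) \<rightarrow> Ext(W,A) \<rightarrow> Ext(W,B) in the
  middle. Since \<open>x\<close> kills \<open>\<theta>\<close>, it maps a realization of
  \<open>\<theta>\<close> to a split sequence; projecting to \<open>B\<close> extends
  \<open>x\<close> along \<open>m\<close>.\<close>

lemma exact_Ext_first:
  assumes r: "realizes D A x B y C \<delta>" and \<theta>: "\<theta> \<in> carrier (Ext D W A)"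
    and zero: "push D W x \<theta> = \<one>\<^bsub>Ext D W B\<^esub>"
  shows "\<exists>g. mor D g W C \<and> pull D A g \<delta> = \<theta>"
proof -
  obtain M m n where M: "realizes D A m M n W \<theta>"
    using ex_realizes[OF \<theta>] by blast
  obtain P i j p q where P: "biproduct D B W P i j p q"
    using ex_biproduct by blast
  have i: "mor D i B P" and p: "mor D p P B" and pi: "p \<cdot> i = \<iota> B"
    using P unfolding biproduct_def by auto
  have x: "mor D x A B" and m: "mor D m A M"
    using realizes_mor[OF r] realizes_mor[OF M] by auto
  have "push D W x \<theta> = pull D B (\<iota> W) \<one>\<^bsub>Ext D W B\<^esub>"
    using zero pull_one[OF ident_mor] by simp
  then obtain b where b: "mor D b M P" "b \<cdot> m = i \<cdot> x"
    using real_mor[OF M real_zero[OF P] x ident_mor] by blast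
  have "(p \<cdot> b) \<cdot> m = p \<cdot> (i \<cdot> x)"
    using comp_assoc[OF m b(1) p] b(2) by simp
  also have "\<dots> = x \<cdot> \<iota> A"
    using comp_assoc[OF x i p] pi ident_left[OF x] ident_right[OF x] by simp
  \<comment> \<open>The square formed by \<open>\<iota> A\<close> and \<open>p \<cdot> b\<close>
    commutes, so \<open>ET3\<close> supplies the third component \<open>g\<close>.\<close>
  finally obtain g where "mor D g W C" "push D W (\<iota> A) \<theta> = pull D A g \<delta>"
    using ET3[OF M r ident_mor comp_mor[OF b(1) p]] by blast
  then show ?thesis
    using push_ident[OF \<theta>] by auto
qed

lemma connecting_map_surj:
  assumes "realizes D A x B y C \<delta>" "trivial_grp (Ext D W B)" "\<theta> \<in> carrier (Ext D W A)"
  shows "\<exists>g. mor D g W C \<and> pull D A g \<delta> = \<theta>"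
proof -
  have "push D W x \<theta> \<in> carrier (Ext D W B)"
    using hom_in_carrier[OF push_hom[OF realizes_mor(1)[OF assms(1)]] assms(3)] .
  then show ?thesis
    using exact_Ext_first[OF assms(1,3)] trivial_grpD[OF assms(2)] by blast
qed

text \<open>Every class is a pullback of \<open>\<delta>\<close> along a map \<open>W\<close>
  \<rightarrow> \<open>C\<close>, and only the zero map is available. Stating this for single
  morphisms covers both a trivial Hom group and a zero object \<open>C\<close>.\<close>

lemma trivial_Ext_first:
  assumes r: "realizes D A x B y C \<delta>"
    and "trivial_grp (Ext D W B)" and Hom: "\<And>g. mor D g W C \<Longrightarrow> g = zero_mor D W C"
  shows "trivial_grp (Ext D W A)"
proof -
  have "\<theta> = \<one>\<^bsub>Ext D W A\<^esub>" if \<theta>: "\<theta> \<in> carrier (Ext D W A)" for \<theta>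
  proof -
    obtain g where "mor D g W C" "pull D A g \<delta> = \<theta>"
      using connecting_map_surj[OF assms(1,2) \<theta>] by blast
    then show ?thesis
      using Hom pull_zero_mor r unfolding realizes_def by blast
  qed
  then show ?thesis
    using group_Ext[of W A] by (auto simp: trivial_grp_def group_def monoid.one_closed)
qed

text \<open>A class is first written as a pullback of \<open>\<delta>\<close> along some
  \<open>g\<close> from \<open>V\<close> to \<open>T\<close>; the obstruction to factoring
  \<open>g\<close> through \<open>f\<close> lies in Ext(V,K) = 0.\<close>

lemma connecting_map_surj_pullback:
  assumes r: "realizes D X d E e T \<delta>" and E: "trivial_grp (Ext D V E)"
    and s: "realizes D K k W f T \<kappa>" and K: "trivial_grp (Ext D V K)"
  shows "(\<lambda>g. pull D X g (pull D X f \<delta>)) ` carrier (Hom D V W) = carrier (Ext D V X)"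
proof (intro equalityI subsetI)
  have f: "mor D f W T"
    using realizes_mor[OF s] by simp
  have \<delta>: "\<delta> \<in> carrier (Ext D T X)" and \<kappa>: "\<kappa> \<in> carrier (Ext D T K)"
    using r s unfolding realizes_def by auto
  show "\<theta> \<in> carrier (Ext D V X)"
    if "\<theta> \<in> (\<lambda>g. pull D X g (pull D X f \<delta>)) ` carrier (Hom D V W)" for \<theta>
    using that hom_in_carrier[OF pull_hom hom_in_carrier[OF pull_hom[OF f] \<delta>]] by blast
  show "\<theta> \<in> (\<lambda>g. pull D X g (pull D X f \<delta>)) ` carrier (Hom D V W)"
    if \<theta>: "\<theta> \<in> carrier (Ext D V X)" for \<theta>
  proof -
    obtain g where g: "mor D g V T" "pull D X g \<delta> = \<theta>"
      using connecting_map_surj[OF r E \<theta>] by blast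
    have "pull D K g \<kappa> = \<one>\<^bsub>Ext D V K\<^esub>"
      using trivial_grpD[OF K hom_in_carrier[OF pull_hom[OF g(1)] \<kappa>]] .
    then obtain h where "mor D h V W" "f \<cdot> h = g"
      using exact_Hom_third[OF s g(1)] by blast
    then show ?thesis
      using pull_comp[OF f _ \<delta>] g(2) by (metis image_eqI)
  qed
qed

end

theorem proposition5p15:
  fixes D :: "('o, 'm, 'e, 'n) neg_extri" and V :: 'o
  assumes "neg_extriangulated_category D"
    and "extended_tilting D V"
  shows "E_universal D V"
proof -
  interpret neg_extriangulated_category D by fact
  have torsion: "\<And>X. \<exists>T\<in>Gen D V. \<exists>F\<in>perp\<^sub>0 D V. \<exists>x y. conflation D T x X y F"
    and Gen_Pres: "Gen D V = Pres D V"
    and Ext_Gen: "\<And>X. X \<in> Gen D V \<Longrightarrow> trivial_grp (Ext D V X)"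
    and cogen: "\<And>X. \<exists>S\<in>Gen D V. \<exists>X' x y. conflation D X x S y X'"
    using assms(2)
    unfolding extended_tilting_def s_torsion_pair_def cogenerating_def perp\<^sub>1_def by auto
  have "\<exists>\<alpha> W A x y \<epsilon>. \<alpha> \<noteq> {} \<and> copower D \<alpha> V W \<and> realizes D X x A y W \<epsilon> \<and>
        (\<lambda>g. pull D X g \<epsilon>) ` carrier (Hom D V W) = carrier (Ext D V X)" for X
  proof -
    obtain S X' x y \<delta> where S: "S \<in> Gen D V" "realizes D X x S y X' \<delta>"
      using cogen[of X] unfolding conflation_def by blast
    obtain T F t u \<tau> where T: "T \<in> Gen D V" "F \<in> perp\<^sub>0 D V" "realizes D T t X' u F \<tau>"
      using torsion[of X'] unfolding conflation_def by blast
    \<comment> \<open>The axiom is applied to the composite \<open>u \<cdot> y\<close> from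
      \<open>S\<close> to \<open>F\<close>.\<close>
    obtain E d e h h' \<eta> where E: "realizes D E h' S h F \<eta>" "realizes D X d E e T (pull D X t \<delta>)"
      using ET4_op[OF S(2) T(3)] by blast
    have "trivial_grp (Hom D V F)"
      using T(2) unfolding perp\<^sub>0_def by simp
    then have Ext_E: "trivial_grp (Ext D V E)"
      by (intro trivial_Ext_first[OF E(1) Ext_Gen[OF S(1)]] trivial_grpD)
    consider "zero_object D T"
      | \<alpha> W K k f where "copower D \<alpha> V W" "conflation D K k W f T" "f \<noteq> zero_mor D W T"
          "K \<in> Gen D V"
      using T(1) Gen_Pres unfolding Pres_def by blast
    then show ?thesis
    proof cases
      case 1
      have Ext_X: "trivial_grp (Ext D V X)"
        by (rule trivial_Ext_first[OF E(2) Ext_E])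
          (rule zero_object_mor_unique[OF 1 _ zero_mor_mor])
      \<comment> \<open>As Ext(V,X) = 0, the split extension by a single copy of \<open>V\<close> is
        universal and has a non-empty index set.\<close>
      obtain P i j p q where "biproduct D X V P i j p q"
        using ex_biproduct by blast
      then have "realizes D X i P q V \<one>\<^bsub>Ext D V X\<^esub>"
        by (rule real_zero)
      moreover have "(\<lambda>g. pull D X g \<one>\<^bsub>Ext D V X\<^esub>) ` carrier (Hom D V V) = carrier (Ext D V X)"
        using Ext_X ident_mor[of V] pull_one unfolding trivial_grp_def by auto
      ultimately show ?thesis
        using copower_singleton[of V] by blast
    next
      case 2
      obtain \<kappa> where K: "realizes D K k W f T \<kappa>"
        using 2(2) unfolding conflation_def by blast
      have f: "mor D f W T"
        using realizes_mor[OF K] by simp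
      \<comment> \<open>Otherwise \<open>W\<close> would be initial and \<open>f\<close> would be
        zero.\<close>
      have "\<alpha> \<noteq> {}"
        using copower_empty_mor_unique[OF _ f zero_mor_mor] 2(1,3) by blast
      moreover have "pull D X f (pull D X t \<delta>) \<in> carrier (Ext D W X)"
        using hom_in_carrier[OF pull_hom[OF f]] E(2) unfolding realizes_def by blast
      then obtain A a b where "realizes D X a A b W (pull D X f (pull D X t \<delta>))"
        using ex_realizes by blast
      ultimately show ?thesis
        using 2(1) connecting_map_surj_pullback[OF E(2) Ext_E K Ext_Gen[OF 2(4)]] by blast
    qed
  qed
  then show ?thesis
    unfolding E_universal_def pull_def by blast
qed

end
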